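(* If $f\in\mathcal{F}$, then $f(1)=0$, $f(2)\in\{0,1\}$, and for all $n>2$, $3-n\le f(n)\le n-1$.
   Context: All sequences are integer sequences indexed from 1. $\mathcal{Q}$ is the set of all infinite sequences $(q(n))_{n\in\mathbb{N}}$ with $1\le q(n)\le n$ for all $n\in\mathbb{N}$. For $q\in\mathcal{Q}$, $F(q)$ denotes the sequence $f$ with $f(1)=0$ and $f(n)=q(n)-q(n-q(n-1))$ for $n>1$. $\mathcal{F}:=\{F(q): q\in\mathcal{Q}\}$. *)

theory Defs
  imports Main
begin

text \<open>
  Integer sequences indexed from 1 are functions \<^typ>\<open>nat \<Rightarrow> int\<close>; the argument 0 is not
  an index, and the value there carries no information.
\<close>

definition \<Q> :: "(nat \<Rightarrow> int) set" where
  "\<Q> = {q. \<forall>n\<ge>1. 1 \<le> q n \<and> q n \<le> int n}"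

text \<open>
  For \<open>q \<in> \<Q>\<close> and \<open>n > 1\<close> we have \<open>1 \<le> int n - q (n - 1) < int n\<close>, so the conversion
  \<^const>\<open>nat\<close> in the index loses nothing. The value at the non-index 0 is fixed to be 0.
\<close>

definition F :: "(nat \<Rightarrow> int) \<Rightarrow> nat \<Rightarrow> int" where
  "F q n = (if n \<le> 1 then 0 else q n - q (nat (int n - q (n - 1))))"

definition \<F> :: "(nat \<Rightarrow> int) set" where
  "\<F> = {F q | q. q \<in> \<Q>}"

end

theory Submission
  imports Defs
begin

text \<open>
  For \<open>n > 1\<close> the value \<open>f n\<close> is the difference of \<open>q n\<close> and \<open>q m\<close>, where \<open>m = n - q (n - 1)\<close>
  lies between \<open>1\<close> and \<open>n - 1\<close>. The crude estimates \<open>1 \<le> q n \<le> n\<close> and \<open>1 \<le> q m \<le> n - 1\<close> give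
  the upper bound, but only \<open>2 - n\<close> from below. The missing unit comes from the dependence of \<open>m\<close>
  on \<open>q\<close>: the value \<open>q m = n - 1\<close> would force \<open>m = n - 1\<close>, hence \<open>q (n - 1) = 1\<close>, so that
  \<open>n - 1 = q m = 1\<close>. This is possible for \<open>n = 2\<close> only, where \<open>q 1 = 1\<close> settles the matter.
\<close>

theorem lemma2p5:
  fixes f :: "nat \<Rightarrow> int"
  assumes "f \<in> \<F>"
  shows "f 1 = 0 \<and> f 2 \<in> {0, 1} \<and> (\<forall>n>2. 3 - int n \<le> f n \<and> f n \<le> int n - 1)"
proof -
  obtain q where f: "f = F q" and q: "\<And>n. n \<ge> 1 \<Longrightarrow> 1 \<le> q n \<and> q n \<le> int n"
    using assms unfolding \<F>_def \<Q>_def by blast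
  have f1: "f 1 = 0"
    by (simp add: f F_def)
  have q1: "q 1 = 1"
    using q[of 1] by simp
  then have "f 2 = q 2 - 1"
    by (simp add: f F_def)
  then have f2: "f 2 \<in> {0, 1}"
    using q[of 2] by auto
  have bounds: "3 - int n \<le> f n \<and> f n \<le> int n - 1" if n: "n > 2" for n
  proof -
    define m where "m = nat (int n - q (n - 1))"
    have prev: "1 \<le> q (n - 1)" "q (n - 1) \<le> int n - 1"
      using q[of "n - 1"] n by auto
    then have m: "int m = int n - q (n - 1)"
      by (simp add: m_def)
    have fn: "f n = q n - q m"
      using n by (simp add: f F_def m_def)
    have qm: "1 \<le> q m" "q m \<le> int m"
      using q[of m] m prev by auto
    have "q m \<le> int n - 2"
    proof (cases "m = n - 1")
      case True
      then have "q m = 1"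
        using m n by auto
      then show ?thesis
        using n by simp
    next
      case False
      then show ?thesis
        using m prev qm by linarith
    qed
    then show ?thesis
      using fn qm(1) q[of n] n by auto
  qed
  show ?thesis
    using f1 f2 bounds by blast
qed

end
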